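(* Let $0<\alpha<1$, and let $\{\omega_n\}_{n\ge0}$ be the power series coefficients at $\xi=0$ of one of the following generating functions: (i) (BT-$\theta$ method) $\displaystyle\omega(\xi)=\Big[\frac{1-\theta+\theta\xi}{(3/2-\theta)-(2-2\theta)\xi+(1/2-\theta)\xi^2}\Big]^{\alpha}$ with $\theta\in(-\infty,\tfrac12]$; or (ii) (BN-$\theta$ method) $\displaystyle\omega(\xi)=\frac{1-\alpha\theta+\alpha\theta\xi}{\big[(3/2-\theta)-(2-2\theta)\xi+(1/2-\theta)\xi^2\big]^{\alpha}}$ with $\theta\in(-\infty,1]$. Then the stability region $S$ of the fractional convolution quadrature with weights $\{\omega_n\}$ is $$S=\mathbb{C}\setminus\{1/\omega(\xi):|\xi|\le1\}.$$
   Context: Stability region: the quadrature is applied to the Abel integral equation of the second kind $u(x)=f(x)+\frac{\lambda}{\Gamma(\alpha)}\int_0^x(x-s)^{\alpha-1}u(s)\,ds$, giving with $x_n=nh$ the scheme $$u^n=f(x_n)+\lambda h^{\alpha}\sum_{j=0}^{n}\omega_{n-j}u^j,\qquad n=0,1,2,\dots.$$ The stability region $S$ is the set of all complex $z=\lambda h^{\alpha}$ for which the numerical solution $\{u^n\}$ of this scheme (which must be well defined, i.e. $1-z\omega_0\neq0$) satisfies $u^n\to0$ as $n\to\infty$ for every sequence $\{f(x_n)\}_{n\ge0}$ of complex numbers having a finite limit. Conventions: $(3/2-\theta)-(2-2\theta)\xi+(1/2-\theta)\xi^2=(\tfrac32-\theta)(1-\xi)(1-\gamma\xi)$ with $\gamma=\frac{1-2\theta}{3-2\theta}$;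 powers are the branches on $|\xi|<1$ that are positive at $\xi=0$, and $\omega$ is extended continuously to $|\xi|\le1$ as a map into $\mathbb{C}\cup\{\infty\}$. One puts $1/\infty=0$ (so $1/\omega(1)=0$), and $1/0=\infty$, which is not an element of $\mathbb{C}$. *)

theory Defs
  imports "HOL-Complex_Analysis.Complex_Analysis"
begin

(* g is, on the open unit disc, the branch of F^a that is positive at 0: a branch of F^a
   is exp (a L) for some holomorphic logarithm L of F. *)
definition is_power_branch :: "real \<Rightarrow> (complex \<Rightarrow> complex) \<Rightarrow> (complex \<Rightarrow> complex) \<Rightarrow> bool" where
  "is_power_branch a F g \<longleftrightarrow>
     (\<exists>L. L holomorphic_on ball 0 1 \<and>
          (\<forall>\<xi>\<in>ball 0 1. exp (L \<xi>) = F \<xi> \<and> g \<xi> = exp (of_real a * L \<xi>))) \<and>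
     (\<exists>r>0. g 0 = of_real r)"

(* Determined on the open unit disc only; nothing below depends on values outside it. *)
definition power_branch :: "real \<Rightarrow> (complex \<Rightarrow> complex) \<Rightarrow> complex \<Rightarrow> complex" where
  "power_branch a F = (SOME g. is_power_branch a F g)"

definition theta_poly :: "real \<Rightarrow> complex \<Rightarrow> complex" where
  "theta_poly \<theta> \<xi> =
     of_real (3/2 - \<theta>) - of_real (2 - 2 * \<theta>) * \<xi> + of_real (1/2 - \<theta>) * \<xi>\<^sup>2"

definition BT_gen :: "real \<Rightarrow> real \<Rightarrow> complex \<Rightarrow> complex" where
  "BT_gen \<alpha> \<theta> =
     power_branch \<alpha> (\<lambda>\<xi>. (of_real (1 - \<theta>) + of_real \<theta> * \<xi>) / theta_poly \<theta> \<xi>)"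

definition BN_gen :: "real \<Rightarrow> real \<Rightarrow> complex \<Rightarrow> complex" where
  "BN_gen \<alpha> \<theta> \<xi> =
     (of_real (1 - \<alpha> * \<theta>) + of_real (\<alpha> * \<theta>) * \<xi>) / power_branch \<alpha> (theta_poly \<theta>) \<xi>"

definition quadrature_weights :: "(complex \<Rightarrow> complex) \<Rightarrow> nat \<Rightarrow> complex" where
  "quadrature_weights \<omega> n = fps_nth (fps_expansion \<omega> 0) n"

(* f n stands for f(x_n), and z for lambda h^alpha. *)
definition numerical_solution ::
  "(nat \<Rightarrow> complex) \<Rightarrow> complex \<Rightarrow> (nat \<Rightarrow> complex) \<Rightarrow> (nat \<Rightarrow> complex) \<Rightarrow> bool" where
  "numerical_solution w z f u \<longleftrightarrow> (\<forall>n. u n = f n + z * (\<Sum>j=0..n. w (n - j) * u j))"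

(* The condition 1 - z w_0 \<noteq> 0 makes the numerical solution exist and be unique for each f. *)
definition stability_region :: "(nat \<Rightarrow> complex) \<Rightarrow> complex set" where
  "stability_region w =
     {z. 1 - z * w 0 \<noteq> 0 \<and>
         (\<forall>f u. convergent f \<and> numerical_solution w z f u \<longrightarrow> u \<longlonglongrightarrow> 0)}"

(* The Riemann sphere: None is the point at infinity. *)
abbreviation riemann_sphere :: "complex option topology" where
  "riemann_sphere \<equiv> Alexandroff_compactification euclidean"

(* The extension by continuity, to the closed unit disc, of a function on the open unit disc. *)
definition sphere_extension :: "(complex \<Rightarrow> complex) \<Rightarrow> complex \<Rightarrow> complex option" where
  "sphere_extension \<omega> \<xi> =
     (THE l. limitin riemann_sphere (\<lambda>\<eta>. Some (\<omega> \<eta>)) l (at \<xi> within ball 0 1))"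

fun sphere_inverse :: "complex option \<Rightarrow> complex option" where
  "sphere_inverse None = Some 0"
| "sphere_inverse (Some w) = (if w = 0 then None else Some (1 / w))"

lemma is_power_branch_power_branch:
  assumes "F holomorphic_on ball 0 1" and "\<And>\<xi>. \<xi> \<in> ball 0 1 \<Longrightarrow> F \<xi> \<noteq> 0"
    and "r > 0" and "F 0 = of_real r"
  shows "is_power_branch a F (power_branch a F)"
proof -
  have "contractible (ball (0::complex) 1)"
    by (simp add: convex_imp_contractible)
  then obtain L where L: "L holomorphic_on ball 0 1" "\<And>\<xi>. \<xi> \<in> ball 0 1 \<Longrightarrow> F \<xi> = exp (L \<xi>)"
    using contractible_imp_holomorphic_log[OF assms(1) _ assms(2)] by metis
  define M where "M = (\<lambda>\<xi>. L \<xi> - L 0 + of_real (ln r))"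
  have "exp (M \<xi>) = F \<xi>" if "\<xi> \<in> ball 0 1" for \<xi>
  proof -
    have "exp (M \<xi>) = exp (L \<xi>) / exp (L 0) * exp (of_real (ln r))"
      by (simp add: M_def exp_add exp_diff)
    also have "exp (L 0) = of_real r"
      using L(2)[of 0] assms(4) by simp
    also have "exp (of_real (ln r)) = (of_real r :: complex)"
      using assms(3) by (metis exp_ln exp_of_real)
    finally show ?thesis
      using assms(3) L(2)[OF that] by simp
  qed
  moreover have "M holomorphic_on ball 0 1"
    unfolding M_def by (intro holomorphic_intros L(1))
  moreover have "exp (of_real a * M 0) = of_real (exp (a * ln r))"
    by (simp add: M_def flip: exp_of_real)
  ultimately have "is_power_branch a F (\<lambda>\<xi>. exp (of_real a * M \<xi>))"
    unfolding is_power_branch_def by (metis exp_gt_zero)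
  then show ?thesis
    unfolding power_branch_def by (rule someI[where P = "is_power_branch a F"])
qed

lemma sphere_extension_eqI:
  assumes "continuous_map (top_of_set (cball 0 1)) riemann_sphere \<Omega>"
    and "\<And>\<eta>. \<eta> \<in> ball 0 1 \<Longrightarrow> \<Omega> \<eta> = Some (\<omega> \<eta>)" and "\<xi> \<in> cball 0 1"
  shows "sphere_extension \<omega> \<xi> = \<Omega> \<xi>"
proof -
  have H: "Hausdorff_space riemann_sphere"
    by (simp add: Hausdorff_space_Alexandroff_compactification
        locally_compact_space_euclidean)
  have nt: "at \<xi> within ball 0 1 \<noteq> bot"
    using assms(3) by (simp add: trivial_limit_within islimpt_ball)
  have "limitin riemann_sphere \<Omega> (\<Omega> \<xi>) (atin (top_of_set (cball 0 1)) \<xi>)"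
    using assms(1,3) by (simp add: continuous_map_atin)
  moreover have "atin (top_of_set (cball 0 1)) \<xi> = at \<xi> within cball 0 1"
  proof -
    have "atin (top_of_set (cball 0 1)) \<xi> = atin_within euclidean \<xi> (cball 0 1)"
      using assms(3) by (rule atin_subtopology_within)
    also have "\<dots> = at \<xi> within cball 0 1"
      by (auto simp: filter_eq_iff eventually_atin_within eventually_at_topological)
    finally show ?thesis .
  qed
  ultimately have "limitin riemann_sphere \<Omega> (\<Omega> \<xi>) (at \<xi> within cball 0 1)"
    by simp
  then have "limitin riemann_sphere \<Omega> (\<Omega> \<xi>) (at \<xi> within ball 0 1)"
    using at_le[OF ball_subset_cball] filter_leD unfolding limitin_def by metis
  then have lim: "limitin riemann_sphere (\<lambda>\<eta>. Some (\<omega> \<eta>)) (\<Omega> \<xi>) (at \<xi> within ball 0 1)"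
    by (rule limitin_transform_eventually[rotated])
       (auto simp: eventually_at_filter assms(2))
  show ?thesis
    unfolding sphere_extension_def
    using lim limitin_Hausdorff_unique[OF _ lim nt H] by (intro the_equality)
qed

end

(* In both cases \<omega> = B / A, where A and B are products of binomial series (1 + c \<xi>)^\<alpha>, |c| \<le> 1,
   and polynomials. As 0 < \<alpha> < 1, these have absolutely summable coefficients, so A and B are continuous on the
   closed disc, where the values 1/\<omega>(\<xi>) \<noteq> \<infinity> are the z at which E = A - z B vanishes somewhere.
   In generating functions, the scheme reads E u = A f.
   If E has no zero, then by Wiener's lemma (proved after Newman) D = A / E has absolutely summable
   coefficients; as D(1) = 0, convolution with D sends convergent sequences to null sequences.
   If E(\<xi>) = 0 \<noteq> A(\<xi>) and \<xi> \<noteq> 0, put V = \<Sum>n. (x / \<xi>)^n: then f = E V tends to 0, but u = A V does not.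
   If E(\<xi>) = 0 = A(\<xi>), then z = 0 and u = f; E(0) = 0 means 1 - z \<omega>(0) = 0. *)
theory Submission
  imports Defs
begin

subsection \<open>Power series with absolutely summable coefficients\<close>

text \<open>The Wiener algebra of power series converging absolutely on the closed unit disc. Its
  members are formal series, so that inverses and quotients exist before their summability is
  known.\<close>

definition fps_l1 :: "complex fps set" where
  "fps_l1 = {F. summable (\<lambda>n. norm (fps_nth F n))}"

definition fps_l1_norm :: "complex fps \<Rightarrow> real" where
  "fps_l1_norm F = (\<Sum>n. norm (fps_nth F n))"

lemma fps_l1_norm_nonneg: "F \<in> fps_l1 \<Longrightarrow> 0 \<le> fps_l1_norm F"
  by (simp add: fps_l1_def fps_l1_norm_def suminf_nonneg)

lemma sum_le_fps_l1_norm: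
  "F \<in> fps_l1 \<Longrightarrow> finite K \<Longrightarrow> (\<Sum>k\<in>K. norm (fps_nth F k)) \<le> fps_l1_norm F"
  by (simp add: fps_l1_def fps_l1_norm_def sum_le_suminf)

lemma fps_l1I:
  assumes "\<And>n. (\<Sum>k\<le>n. norm (fps_nth F k)) \<le> C"
  shows "F \<in> fps_l1" and "fps_l1_norm F \<le> C"
proof -
  have "summable (\<lambda>n. norm (fps_nth F n))"
    by (rule bounded_imp_summable) (use assms in auto)
  then show "F \<in> fps_l1" "fps_l1_norm F \<le> C"
    using LIMSEQ_le_const2[OF summable_LIMSEQ', of "\<lambda>n. norm (fps_nth F n)" C] assms
    by (simp_all add: fps_l1_def fps_l1_norm_def)
qed

lemma fps_l1_const [simp]: "fps_const c \<in> fps_l1"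
  unfolding fps_l1_def mem_Collect_eq by (rule summable_finite[of "{0}"]) auto

lemma fps_l1_X [simp]: "fps_X \<in> fps_l1"
  unfolding fps_l1_def mem_Collect_eq by (rule summable_finite[of "{1}"]) auto

lemma fps_l1_add:
  assumes "F \<in> fps_l1" "G \<in> fps_l1"
  shows "F + G \<in> fps_l1"
proof -
  have "summable (\<lambda>n. norm (fps_nth F n) + norm (fps_nth G n))"
    using assms by (intro summable_add) (simp_all add: fps_l1_def)
  then show ?thesis
    unfolding fps_l1_def mem_Collect_eq
    by (rule summable_comparison_test') (simp add: norm_triangle_ineq)
qed

lemma fps_l1_uminus: "F \<in> fps_l1 \<Longrightarrow> - F \<in> fps_l1"
  by (simp add: fps_l1_def)

lemma fps_l1_diff: "F \<in> fps_l1 \<Longrightarrow> G \<in> fps_l1 \<Longrightarrow> F - G \<in> fps_l1"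
  using fps_l1_add[of F "- G"] by (simp add: fps_l1_uminus)

text \<open>The coefficients of the product are dominated by the Cauchy product of the absolute
  values, whose sum is the product of the norms.\<close>

lemma fps_l1_mult:
  assumes "F \<in> fps_l1" "G \<in> fps_l1"
  shows "F * G \<in> fps_l1" and "fps_l1_norm (F * G) \<le> fps_l1_norm F * fps_l1_norm G"
proof -
  let ?c = "\<lambda>k. \<Sum>i\<le>k. norm (fps_nth F i) * norm (fps_nth G (k - i))"
  have c: "?c sums (fps_l1_norm F * fps_l1_norm G)"
    using assms unfolding fps_l1_def fps_l1_norm_def by (auto intro!: Cauchy_product_sums)
  have le: "norm (fps_nth (F * G) k) \<le> ?c k" for k
    unfolding fps_mult_nth atLeast0AtMost by (rule sum_norm_le) (simp add: norm_mult)
  show "F * G \<in> fps_l1"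
    unfolding fps_l1_def mem_Collect_eq
    by (rule summable_comparison_test'[OF sums_summable[OF c]]) (use le in simp)
  then show "fps_l1_norm (F * G) \<le> fps_l1_norm F * fps_l1_norm G"
    using suminf_le[OF le _ sums_summable[OF c]] sums_unique[OF c]
    by (simp add: fps_l1_def fps_l1_norm_def)
qed

lemma fps_l1_power:
  assumes "F \<in> fps_l1"
  shows "F ^ n \<in> fps_l1" and "fps_l1_norm (F ^ n) \<le> fps_l1_norm F ^ n"
proof -
  have "F ^ n \<in> fps_l1 \<and> fps_l1_norm (F ^ n) \<le> fps_l1_norm F ^ n"
  proof (induction n)
    case 0
    have "fps_l1_norm 1 = 1"
      unfolding fps_l1_norm_def by (subst suminf_finite[of "{0}"]) auto
    then show ?case
      using fps_l1_const[of 1] by simp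
  next
    case (Suc n)
    then show ?case
      using fps_l1_mult[OF assms, of "F ^ n"] fps_l1_norm_nonneg[OF assms]
      by (auto intro: order_trans mult_left_mono)
  qed
  then show "F ^ n \<in> fps_l1" "fps_l1_norm (F ^ n) \<le> fps_l1_norm F ^ n" by auto
qed

section \<open>Evaluation on the closed unit disc\<close>

lemma norm_fps_l1_term_le:
  "norm z \<le> 1 \<Longrightarrow> norm (fps_nth F n * z ^ n) \<le> norm (fps_nth F n)" for z :: complex
  by (simp add: norm_mult norm_power mult_left_le power_le_one)

lemma summable_fps_l1_term:
  assumes "F \<in> fps_l1" "norm z \<le> 1"
  shows "summable (\<lambda>n. norm (fps_nth F n * z ^ n))"
  by (rule summable_comparison_test'[where N = 0 and g = "\<lambda>n. norm (fps_nth F n)"])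
     (use assms norm_fps_l1_term_le in \<open>auto simp: fps_l1_def\<close>)

lemma sums_eval_fps_l1:
  "F \<in> fps_l1 \<Longrightarrow> norm z \<le> 1 \<Longrightarrow> (\<lambda>n. fps_nth F n * z ^ n) sums eval_fps F z"
  unfolding eval_fps_def
  by (rule summable_sums, rule summable_norm_cancel, rule summable_fps_l1_term)

lemma eval_fps_l1_add:
  assumes "F \<in> fps_l1" "G \<in> fps_l1" "norm z \<le> 1"
  shows "eval_fps (F + G) z = eval_fps F z + eval_fps G z"
proof (rule sums_unique2)
  show "(\<lambda>n. fps_nth (F + G) n * z ^ n) sums eval_fps (F + G) z"
    using assms by (intro sums_eval_fps_l1 fps_l1_add)
  show "(\<lambda>n. fps_nth (F + G) n * z ^ n) sums (eval_fps F z + eval_fps G z)"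
    using sums_add[OF sums_eval_fps_l1[OF assms(1,3)] sums_eval_fps_l1[OF assms(2,3)]]
    by (simp add: ring_distribs)
qed

lemma eval_fps_l1_mult:
  assumes "F \<in> fps_l1" "G \<in> fps_l1" "norm z \<le> 1"
  shows "eval_fps (F * G) z = eval_fps F z * eval_fps G z"
proof -
  have "(\<Sum>i\<le>n. fps_nth F i * z ^ i * (fps_nth G (n - i) * z ^ (n - i))) = fps_nth (F * G) n * z ^ n"
    for n
    unfolding fps_mult_nth atLeast0AtMost sum_distrib_right
    by (rule sum.cong) (auto simp: mult_ac simp flip: power_add)
  with Cauchy_product[OF summable_fps_l1_term[OF assms(1,3)] summable_fps_l1_term[OF assms(2,3)]]
  show ?thesis by (simp add: eval_fps_def)
qed

lemma eval_fps_l1_diff_cmult: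
  assumes "F \<in> fps_l1" "G \<in> fps_l1" "norm z \<le> 1"
  shows "eval_fps (F - fps_const c * G) z = eval_fps F z - c * eval_fps G z"
proof -
  have "F - fps_const c * G = F + fps_const (- c) * G"
    by (simp flip: fps_const_neg)
  also have "eval_fps \<dots> z = eval_fps F z - c * eval_fps G z"
    using assms by (simp add: eval_fps_l1_add eval_fps_l1_mult fps_l1_mult del: fps_const_neg)
  finally show ?thesis .
qed

lemma norm_eval_fps_l1_le:
  assumes "F \<in> fps_l1" "norm z \<le> 1"
  shows "norm (eval_fps F z) \<le> fps_l1_norm F"
proof -
  have "norm (eval_fps F z) \<le> (\<Sum>n. norm (fps_nth F n * z ^ n))"
    unfolding eval_fps_def using assms by (intro summable_norm summable_fps_l1_term)
  also have "\<dots> \<le> fps_l1_norm F"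
    unfolding fps_l1_norm_def using assms norm_fps_l1_term_le summable_fps_l1_term
    by (intro suminf_le) (auto simp: fps_l1_def)
  finally show ?thesis .
qed

lemma continuous_on_eval_fps_l1:
  assumes "F \<in> fps_l1"
  shows "continuous_on (cball 0 1) (eval_fps F)"
proof (rule uniform_limit_theorem)
  show "uniform_limit (cball 0 1) (\<lambda>n z. \<Sum>k<n. fps_nth F k * z ^ k) (eval_fps F) sequentially"
    unfolding eval_fps_def
    by (rule Weierstrass_m_test[where M = "\<lambda>n. norm (fps_nth F n)"])
       (use assms norm_fps_l1_term_le in \<open>auto simp: fps_l1_def\<close>)
  show "\<forall>\<^sub>F n in sequentially. continuous_on (cball 0 1) (\<lambda>z. \<Sum>k<n. fps_nth F k * z ^ k)"
    by (intro always_eventually allI continuous_intros)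
qed simp

lemma fps_l1_conv_radius:
  assumes "F \<in> fps_l1"
  shows "fps_conv_radius F \<ge> 1"
  using conv_radius_geI[of "fps_nth F" 1] sums_summable[OF sums_eval_fps_l1[OF assms, of 1]]
  by (simp add: fps_conv_radius_def one_ereal_def)

lemma fps_l1_has_fps_expansion:
  assumes "F \<in> fps_l1" and "\<And>z. norm z < 1 \<Longrightarrow> f z = eval_fps F z"
  shows "f has_fps_expansion F"
  unfolding has_fps_expansion_def
proof
  show "0 < fps_conv_radius F"
    using fps_l1_conv_radius[OF assms(1)] by (rule less_le_trans[rotated]) simp
  show "\<forall>\<^sub>F z in nhds 0. eval_fps F z = f z"
    by (rule eventually_mono[OF eventually_nhds_in_open[of "ball 0 1" "0::complex"]])
       (use assms in auto)
qed

subsection \<open>Wiener's lemma\<close>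

lemma fps_l1_tail:
  assumes "F \<in> fps_l1" "e > 0"
  obtains N where "N > 0" "F - fps_cutoff N F \<in> fps_l1" "fps_l1_norm (F - fps_cutoff N F) \<le> e"
proof -
  have "summable (\<lambda>n. norm (fps_nth F n))"
    using assms(1) by (simp add: fps_l1_def)
  then obtain N where N: "\<And>m n. m \<ge> N \<Longrightarrow> norm (\<Sum>k=m..<n. norm (fps_nth F k)) < e"
    unfolding summable_Cauchy using assms(2) by blast
  \<comment> \<open>Cutting at \<open>Suc N\<close> makes the index positive: the cutoff then keeps
    the constant term, and the tail has none.\<close>
  have "(\<Sum>k\<le>n. norm (fps_nth (F - fps_cutoff (Suc N) F) k)) \<le> e" for n
  proof -
    have "(\<Sum>k\<le>n. norm (fps_nth (F - fps_cutoff (Suc N) F) k)) =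
        (\<Sum>k=Suc N..<Suc n. norm (fps_nth F k))"
      by (rule sum.mono_neutral_cong_right) auto
    moreover have "\<bar>\<Sum>k=Suc N..<Suc n. norm (fps_nth F k)\<bar> < e"
      using N[of "Suc N" "Suc n"] by (simp only: real_norm_def le_SucI order_refl)
    ultimately show ?thesis by linarith
  qed
  from fps_l1I[OF this] that show thesis by blast
qed

lemma fps_cutoff_in_l1: "fps_cutoff N F \<in> fps_l1"
  unfolding fps_l1_def mem_Collect_eq by (rule summable_finite[of "{..<N}"]) auto

lemma eval_fps_cutoff: "eval_fps (fps_cutoff N F) = (\<lambda>z::complex. \<Sum>k<N. fps_nth F k * z ^ k)"
  unfolding eval_fps_def by (intro ext, subst suminf_finite[of "{..<N}"]) auto

text \<open>Cauchy's inequality on the circle of radius \<open>r\<close> bounds the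
  \<open>k\<close>-th coefficient by \<open>inverse d ^ n * (1 / r) ^ k\<close>; summation over
  \<open>k\<close> gives the factor \<open>r / (r - 1)\<close>. The point is that this factor does
  not depend on \<open>n\<close>: submultiplicativity alone would give powers of the norm of
  \<open>inverse P\<close>, possibly much larger than \<open>1 / d\<close>.\<close>

lemma inverse_power_fps_l1:
  fixes P :: "complex fps"
  assumes "f has_fps_expansion P" "f holomorphic_on UNIV" "r > 1" "d > 0"
    and f: "\<And>z. norm z \<le> r \<Longrightarrow> norm (f z) \<ge> d"
  shows "inverse P ^ n \<in> fps_l1" "fps_l1_norm (inverse P ^ n) \<le> inverse d ^ n * (r / (r - 1))"
proof -
  let ?g = "\<lambda>z. inverse (f z) ^ n"
  have nz: "f z \<noteq> 0" if "norm z \<le> r" for z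
    using f[OF that] \<open>d > 0\<close> by auto
  have "fps_nth P 0 \<noteq> 0"
    using nz[of 0] \<open>r > 1\<close> has_fps_expansion_imp_0_eq_fps_nth_0[OF assms(1)] by simp
  then have g: "?g has_fps_expansion inverse P ^ n"
    by (intro fps_expansion_intros assms(1))
  have hol: "?g holomorphic_on cball 0 r"
    using nz by (intro holomorphic_intros holomorphic_on_subset[OF assms(2)]) auto
  have coeff: "norm (fps_nth (inverse P ^ n) k) \<le> inverse d ^ n * (1 / r) ^ k" for k
  proof -
    have "norm ((deriv ^^ k) ?g 0) \<le> fact k * inverse d ^ n / r ^ k"
    proof (rule Cauchy_inequality)
      show "norm (?g x) \<le> inverse d ^ n" if "norm (0 - x) = r" for x
        using f[of x] that \<open>d > 0\<close>
        by (auto simp: norm_power norm_inverse intro!: power_mono le_imp_inverse_le)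
    qed (use hol \<open>r > 1\<close> in \<open>auto intro: holomorphic_on_subset holomorphic_on_imp_continuous_on\<close>)
    then show ?thesis
      by (simp add: fps_nth_fps_expansion[OF g] norm_divide field_simps power_divide)
  qed
  have "(\<Sum>k\<le>m. norm (fps_nth (inverse P ^ n) k)) \<le> inverse d ^ n * (r / (r - 1))" for m
  proof -
    have "(\<Sum>k\<le>m. (1 / r) ^ k) \<le> (\<Sum>k. (1 / r) ^ k)"
      using \<open>r > 1\<close> by (intro sum_le_suminf summable_geometric) auto
    also have "\<dots> = r / (r - 1)"
      using \<open>r > 1\<close> by (subst suminf_geometric) (auto simp: field_simps)
    finally have "inverse d ^ n * (\<Sum>k\<le>m. (1 / r) ^ k) \<le> inverse d ^ n * (r / (r - 1))"
      using \<open>d > 0\<close> by (intro mult_left_mono) auto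
    moreover have "(\<Sum>k\<le>m. norm (fps_nth (inverse P ^ n) k)) \<le> (\<Sum>k\<le>m. inverse d ^ n * (1 / r) ^ k)"
      by (intro sum_mono coeff)
    ultimately show ?thesis
      by (simp only: flip: sum_distrib_left)
  qed
  from fps_l1I[OF this]
  show "inverse P ^ n \<in> fps_l1" "fps_l1_norm (inverse P ^ n) \<le> inverse d ^ n * (r / (r - 1))" .
qed

text \<open>A Neumann series stopped after \<open>N\<close> terms, with exact remainder; as an
  identity of formal series it needs no convergence.\<close>

lemma fps_inverse_split:
  fixes P T :: "complex fps"
  assumes "fps_nth P 0 \<noteq> 0" "fps_nth T 0 = 0"
  shows "inverse (P + T) =
    (\<Sum>n<N. (- T) ^ n * inverse P ^ Suc n) + (- T) ^ N * (inverse P ^ N * inverse (P + T))"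
proof (induction N)
  case (Suc N)
  let ?R = "inverse P" and ?G = "inverse (P + T)"
  have "?R * P = 1" "(P + T) * ?G = 1"
    using assms by (auto simp: inverse_mult_eq_1 inverse_mult_eq_1')
  \<comment> \<open>Multiply \<open>(P + T) * ?G = 1\<close> by \<open>?R\<close> and use
    \<open>?R * P = 1\<close>; each use of the result moves one more term out of the
    remainder.\<close>
  then have "?G = ?R - ?R * T * ?G"
    by algebra
  then have "(- T) ^ N * (?R ^ N * ?G) = (- T) ^ N * (?R ^ N * (?R - ?R * T * ?G))"
    by simp
  also have "\<dots> = (- T) ^ N * ?R ^ Suc N + (- T) ^ Suc N * (?R ^ Suc N * ?G)"
    by (simp add: algebra_simps)
  finally show ?case
    using Suc by (simp only: sum.lessThan_Suc add.assoc)
qed simp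

text \<open>\<open>T\<close> is divisible by \<open>fps_X\<close>, hence \<open>T ^ N * G\<close> by
  \<open>fps_X ^ N\<close>. This removes the remainder of the truncated Neumann series from the
  coefficients below \<open>N\<close>.\<close>

lemma fps_nth_power_mult_eq_0:
  fixes T G :: "complex fps"
  assumes "fps_nth T 0 = 0" "k < N"
  shows "fps_nth (T ^ N * G) k = 0"
proof -
  have "T = fps_X * fps_shift 1 T"
    using assms(1) by (simp add: fps_eq_iff)
  then have "T ^ N = fps_X ^ N * fps_shift 1 T ^ N"
    by (metis power_mult_distrib)
  then show ?thesis
    using assms(2) by (simp add: mult.assoc fps_X_power_mult_nth)
qed

text \<open>
  With \<open>P\<close> a partial sum of \<open>F\<close> and \<open>T\<close> the remaining tail, \<open>1 / F\<close> is the series of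
  \<open>(- T)\<^sup>n / P\<^sup>n\<^sup>+\<^sup>1\<close>. Since \<open>P\<close> stays away from \<open>0\<close> on a slightly larger disc, Cauchy's inequality
  bounds the norms of \<open>1 / P\<^sup>n\<close>. As \<open>T\<close> has no constant term, each coefficient of the series is
  a finite sum.
\<close>
theorem fps_l1_inverse:
  assumes F: "F \<in> fps_l1" and nz: "\<And>z. norm z \<le> 1 \<Longrightarrow> eval_fps F z \<noteq> 0"
  shows "inverse F \<in> fps_l1"
proof -
  obtain m where m: "m > 0" "\<And>z. norm z \<le> 1 \<Longrightarrow> norm (eval_fps F z) \<ge> m"
  proof -
    have "\<exists>x\<in>cball 0 1. \<forall>y\<in>cball 0 1. norm (eval_fps F x) \<le> norm (eval_fps F y)"
      using continuous_on_norm[OF continuous_on_eval_fps_l1[OF F]]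
      by (intro continuous_attains_inf) auto
    then obtain x where "norm x \<le> 1" "\<And>y. norm y \<le> 1 \<Longrightarrow> norm (eval_fps F x) \<le> norm (eval_fps F y)"
      by auto
    then show thesis
      using nz[of x] by (intro that[of "norm (eval_fps F x)"]) auto
  qed
  \<comment> \<open>A tail of norm at most \<open>m / 3\<close> leaves the partial sum with modulus
    at least \<open>2 * m / 3\<close> on the unit disc, hence \<open>m / 2\<close> on a slightly
    larger one; the Neumann ratio is then \<open>(m / 3) * (2 / m) = 2 / 3\<close>.\<close>
  from \<open>m > 0\<close> have "m / 3 > 0" by simp
  from fps_l1_tail[OF F this] obtain N where N: "N > 0"
    "F - fps_cutoff N F \<in> fps_l1" "fps_l1_norm (F - fps_cutoff N F) \<le> m / 3" .
  define P where "P = fps_cutoff N F"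
  define T where "T = F - P"
  define p where "p = eval_fps P"
  have F_eq: "F = P + T" by (simp add: T_def)
  have T: "T \<in> fps_l1" "fps_l1_norm T \<le> m / 3"
    using N by (simp_all add: T_def P_def)
  have P: "P \<in> fps_l1"
    by (simp add: P_def fps_cutoff_in_l1)
  have p_lower: "norm (p z) \<ge> 2 * m / 3" if "norm z \<le> 1" for z
  proof -
    have "eval_fps F z = p z + eval_fps T z"
      using eval_fps_l1_add[OF P T(1) that] by (simp add: p_def flip: F_eq)
    then show ?thesis
      using m(2)[OF that] norm_eval_fps_l1_le[OF T(1) that] T(2)
        norm_triangle_ineq[of "p z" "eval_fps T z"] by simp
  qed
  have p_hol: "p holomorphic_on UNIV"
    unfolding p_def P_def eval_fps_cutoff by (intro holomorphic_intros)
  \<comment> \<open>The partial sum is a polynomial, so a slightly weaker lower bound survives in an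
    open neighbourhood of the compact disc.\<close>
  have "open {z. norm (p z) > m / 2}"
    using holomorphic_on_imp_continuous_on[OF p_hol]
    by (intro open_Collect_less continuous_intros) auto
  moreover have "cball 0 1 \<subseteq> {z. norm (p z) > m / 2}"
    using p_lower \<open>m > 0\<close> by fastforce
  ultimately obtain e where e: "e > 0" "(\<Union>x\<in>cball 0 1. cball x e) \<subseteq> {z. norm (p z) > m / 2}"
    using compact_subset_open_imp_cball_epsilon_subset[OF compact_cball] by metis
  have p_lower': "norm (p z) \<ge> m / 2" if z: "norm z \<le> 1 + e" for z
  proof -
    have "z \<in> (\<Union>x\<in>cball 0 1. cball x e)"
    proof (cases "norm z \<le> 1")
      case True
      with \<open>e > 0\<close> show ?thesis by (intro UN_I[of z]) auto
    next
      case False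
      \<comment> \<open>Radial projection: \<open>sgn z\<close> is the point of the unit circle
        nearest to \<open>z\<close>.\<close>
      have "z - sgn z = (1 - inverse (norm z)) *\<^sub>R z"
        by (simp add: sgn_div_norm scaleR_left_diff_distrib)
      then have "dist (sgn z) z = \<bar>1 - inverse (norm z)\<bar> * norm z"
        by (metis dist_commute dist_norm norm_scaleR)
      also have "\<dots> = norm z - 1"
        using False by (auto simp: field_simps abs_if)
      finally have "dist (sgn z) z \<le> e" using z by simp
      then show ?thesis
        by (intro UN_I[of "sgn z"]) (auto simp: norm_sgn)
    qed
    with e(2) have "z \<in> {z. norm (p z) > m / 2}" by (rule subsetD)
    then show ?thesis by simp
  qed
  have "p has_fps_expansion P"
    unfolding p_def by (rule fps_l1_has_fps_expansion[OF P]) simp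
  define C where "C = (1 + e) / e"
  have R: "inverse P ^ n \<in> fps_l1" "fps_l1_norm (inverse P ^ n) \<le> (2 / m) ^ n * C" for n
    using inverse_power_fps_l1[OF \<open>p has_fps_expansion P\<close> p_hol _ _ p_lower',
        where n = n and r = "1 + e"]
      \<open>m > 0\<close> \<open>e > 0\<close>
    by (simp_all add: C_def)
  have P0: "fps_nth P 0 \<noteq> 0" and T0: "fps_nth T 0 = 0"
    using p_lower[of 0] \<open>m > 0\<close> \<open>N > 0\<close> by (auto simp: p_def eval_fps_at_0 T_def P_def)
  \<comment> \<open>The bound, independent of \<open>K\<close>, is \<open>2 * C / m\<close> times
    the sum \<open>3\<close> of the geometric series of ratio \<open>2 / 3\<close>.\<close>
  have "(\<Sum>k\<le>K. norm (fps_nth (inverse F) k)) \<le> 6 * C / m" for K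
  proof -
    let ?S = "\<lambda>n. (- T) ^ n * inverse P ^ Suc n"
    have S: "?S n \<in> fps_l1" "fps_l1_norm (?S n) \<le> (2 * C / m) * (2 / 3) ^ n" for n
    proof -
      have T': "- T \<in> fps_l1" "fps_l1_norm (- T) \<le> m / 3"
        using T by (simp_all add: fps_l1_uminus fps_l1_norm_def)
      note Tn = fps_l1_power[OF T'(1), of n]
      show "?S n \<in> fps_l1"
        using Tn(1) R(1)[of "Suc n"] by (rule fps_l1_mult)
      have "fps_l1_norm (?S n) \<le> fps_l1_norm ((- T) ^ n) * fps_l1_norm (inverse P ^ Suc n)"
        using Tn(1) R(1)[of "Suc n"] by (rule fps_l1_mult)
      also have "\<dots> \<le> (m / 3) ^ n * ((2 / m) ^ Suc n * C)"
      proof (intro mult_mono R)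
        show "fps_l1_norm ((- T) ^ n) \<le> (m / 3) ^ n"
          using Tn(2) power_mono[OF T'(2) fps_l1_norm_nonneg[OF T'(1)], of n] by simp
        show "0 \<le> fps_l1_norm (inverse P ^ Suc n)"
          using R(1)[of "Suc n"] by (rule fps_l1_norm_nonneg)
      qed (use \<open>m > 0\<close> in auto)
      also have "\<dots> = (2 * C / m) * (2 / 3) ^ n"
        using \<open>m > 0\<close> by (simp add: power_divide field_simps)
      finally show "fps_l1_norm (?S n) \<le> (2 * C / m) * (2 / 3) ^ n" .
    qed
    \<comment> \<open>Truncation at order \<open>Suc K\<close> suffices: the remainder contributes
      nothing to the coefficients up to index \<open>K\<close>.\<close>
    have "fps_nth (inverse F) k = (\<Sum>n<Suc K. fps_nth (?S n) k)" if "k \<le> K" for k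
    proof -
      have "fps_nth ((- T) ^ Suc K * (inverse P ^ Suc K * inverse (P + T))) k = 0"
        using T0 that by (intro fps_nth_power_mult_eq_0) auto
      then show ?thesis
        unfolding F_eq by (subst fps_inverse_split[OF P0 T0, of "Suc K"]) (simp add: fps_sum_nth)
    qed
    then have "(\<Sum>k\<le>K. norm (fps_nth (inverse F) k)) \<le> (\<Sum>k\<le>K. \<Sum>n<Suc K. norm (fps_nth (?S n) k))"
      by (intro sum_mono) (simp only: atMost_iff norm_sum)
    also have "\<dots> = (\<Sum>n<Suc K. \<Sum>k\<le>K. norm (fps_nth (?S n) k))"
      by (rule sum.swap)
    also have "\<dots> \<le> (\<Sum>n<Suc K. (2 * C / m) * (2 / 3) ^ n)"
      using S by (intro sum_mono order_trans[OF sum_le_fps_l1_norm]) auto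
    also have "\<dots> = (2 * C / m) * (\<Sum>n<Suc K. (2 / 3) ^ n)"
      by (rule sum_distrib_left[symmetric])
    also have "\<dots> \<le> (2 * C / m) * (\<Sum>n. (2 / 3) ^ n)"
      using \<open>m > 0\<close> \<open>e > 0\<close>
      by (intro mult_left_mono sum_le_suminf summable_geometric) (auto simp: C_def)
    also have "\<dots> = 6 * C / m"
      by (subst suminf_geometric) auto
    finally show ?thesis .
  qed
  then show ?thesis by (rule fps_l1I)
qed

subsection \<open>Stability region for a quotient of absolutely summable series\<close>

lemma fps_nth_Abs_fps_fun [simp]: "fps_nth (Abs_fps f) = f"
  by (simp add: fun_eq_iff)

text \<open>Dominated convergence for series: each term of the convolution tends to \<open>0\<close>
  as \<open>n\<close> grows, and \<open>norm (fps_nth D k)\<close> times a bound for the null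
  sequence is a summable majorant.\<close>

lemma fps_l1_mult_null_sequence:
  assumes D: "D \<in> fps_l1" and f: "fps_nth F \<longlonglongrightarrow> 0"
  shows "fps_nth (D * F) \<longlonglongrightarrow> 0"
proof -
  obtain M where M: "\<And>n. norm (fps_nth F n) \<le> M"
    using convergent_imp_Bseq[OF convergentI[OF f]] unfolding Bseq_def by blast
  define a where "a = (\<lambda>k n. if k \<le> n then fps_nth D k * fps_nth F (n - k) else 0)"
  have "(\<lambda>n. suminf (\<lambda>k. a k n)) \<longlonglongrightarrow> suminf (\<lambda>k. 0)"
  proof (intro conjunct2[OF conjunct2[OF tannerys_theorem]])
    show "a k \<longlonglongrightarrow> 0" for k
    proof -
      have "(\<lambda>n. fps_nth D k * fps_nth F n) \<longlonglongrightarrow> 0"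
        using tendsto_mult_left[OF f, of "fps_nth D k"] by simp
      then have "(\<lambda>n. a k (n + k)) \<longlonglongrightarrow> 0"
        by (simp add: a_def)
      then show ?thesis by (rule LIMSEQ_offset)
    qed
    have "norm (a k n) \<le> norm (fps_nth D k) * M" for k n
      using M[of "n - k"] order_trans[OF norm_ge_zero M[of 0]]
      by (auto simp: a_def norm_mult intro!: mult_left_mono)
    then show "\<forall>\<^sub>F (k, n) in sequentially \<times>\<^sub>F sequentially. norm (a k n) \<le> norm (fps_nth D k) * M"
      by (simp add: always_eventually)
    show "summable (\<lambda>k. norm (fps_nth D k) * M)"
      using D by (simp add: fps_l1_def summable_mult2)
  qed simp
  moreover have "suminf (\<lambda>k. a k n) = fps_nth (D * F) n" for n
  proof -
    have "suminf (\<lambda>k. a k n) = (\<Sum>k\<le>n. a k n)"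
      by (rule suminf_finite) (auto simp: a_def)
    then show ?thesis by (simp add: a_def fps_mult_nth atLeast0AtMost)
  qed
  ultimately show ?thesis by simp
qed

text \<open>Subtracting the limit \<open>l\<close> leaves a null sequence; the constant part
  contributes \<open>l\<close> times the partial sums of \<open>D\<close>, which tend to
  \<open>eval_fps D 1 = 0\<close>.\<close>

lemma fps_l1_mult_convergent_sequence:
  assumes D: "D \<in> fps_l1" "eval_fps D 1 = 0" and f: "convergent (fps_nth F)"
  shows "fps_nth (D * F) \<longlonglongrightarrow> 0"
proof -
  obtain l where l: "fps_nth F \<longlonglongrightarrow> l"
    using f by (auto simp: convergent_def)
  define G where "G = Abs_fps (\<lambda>n. fps_nth F n - l)"
  have "fps_nth G \<longlonglongrightarrow> 0"
    using l by (simp add: G_def LIM_zero)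
  then have "fps_nth (D * G) \<longlonglongrightarrow> 0"
    by (rule fps_l1_mult_null_sequence[OF D(1)])
  moreover have "(\<lambda>n. \<Sum>k\<le>n. fps_nth D k) \<longlonglongrightarrow> 0"
    using sums_eval_fps_l1[OF D(1), of 1] D(2) by (simp add: sums_def_le)
  ultimately have "(\<lambda>n. fps_nth (D * G) n + (\<Sum>k\<le>n. fps_nth D k) * l) \<longlonglongrightarrow> 0 + 0 * l"
    by (intro tendsto_intros)
  moreover have "fps_nth (D * G) n + (\<Sum>k\<le>n. fps_nth D k) * l = fps_nth (D * F) n" for n
    by (simp add: fps_mult_nth G_def atLeast0AtMost algebra_simps sum_subtractf sum_distrib_left)
  ultimately show ?thesis by simp
qed

text \<open>The \<open>n\<close>-th coefficient of the product is \<open>inverse \<xi> ^ n\<close>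
  times the partial sum of \<open>F\<close> at \<open>\<xi>\<close> up to index \<open>n\<close>. If
  \<open>F\<close> vanishes there, that partial sum is minus the remaining tail, whose terms all
  contain a power of \<open>\<xi>\<close> beyond the \<open>n\<close>-th; so the coefficient is
  bounded by the tail of the norm series, even when \<open>norm \<xi> < 1\<close> and the geometric
  sequence grows.\<close>

lemma fps_l1_geometric_limit:
  assumes "F \<in> fps_l1" "\<xi> \<noteq> 0" "norm \<xi> \<le> 1"
  shows "(\<lambda>n. \<xi> ^ n * fps_nth (F * Abs_fps (\<lambda>n. inverse \<xi> ^ n)) n) \<longlonglongrightarrow> eval_fps F \<xi>"
    (is "?f \<longlonglongrightarrow> _")
    and "eval_fps F \<xi> = 0 \<Longrightarrow> fps_nth (F * Abs_fps (\<lambda>n. inverse \<xi> ^ n)) \<longlonglongrightarrow> 0"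
proof -
  have eq: "?f n = (\<Sum>k\<le>n. fps_nth F k * \<xi> ^ k)" for n
    unfolding fps_mult_nth atLeast0AtMost sum_distrib_left using \<open>\<xi> \<noteq> 0\<close>
    by (intro sum.cong) (auto simp: power_diff power_inverse field_simps)
  note sums = sums_eval_fps_l1[OF assms(1,3)]
  show "?f \<longlonglongrightarrow> eval_fps F \<xi>"
    using sums unfolding eq sums_def_le .
  assume 0: "eval_fps F \<xi> = 0"
  define tail where "tail = (\<lambda>n. \<Sum>k. norm (fps_nth F (k + Suc n)))"
  have summ: "summable (\<lambda>k. norm (fps_nth F k))"
    using assms(1) by (simp add: fps_l1_def)
  have "tail = (\<lambda>n. fps_l1_norm F - (\<Sum>k\<le>n. norm (fps_nth F k)))"
    unfolding tail_def fps_l1_norm_def lessThan_Suc_atMost[symmetric]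
    by (intro ext suminf_minus_initial_segment[OF summ])
  moreover have "(\<lambda>n. fps_l1_norm F - (\<Sum>k\<le>n. norm (fps_nth F k))) \<longlonglongrightarrow> fps_l1_norm F - fps_l1_norm F"
    unfolding fps_l1_norm_def by (intro tendsto_diff tendsto_const summable_LIMSEQ'[OF summ])
  ultimately have "tail \<longlonglongrightarrow> 0" by simp
  moreover have "norm (fps_nth (F * Abs_fps (\<lambda>n. inverse \<xi> ^ n)) n) \<le> tail n" for n
  proof -
    have "(\<lambda>k. fps_nth F (k + Suc n) * \<xi> ^ (k + Suc n)) sums (0 - ?f n)"
      using sums_split_initial_segment[OF sums, of "Suc n"] 0
      by (simp add: eq lessThan_Suc_atMost)
    then have "(\<lambda>k. inverse \<xi> ^ n * (fps_nth F (k + Suc n) * \<xi> ^ (k + Suc n)))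
        sums (inverse \<xi> ^ n * (0 - ?f n))"
      by (rule sums_mult)
    moreover have "inverse \<xi> ^ n * (fps_nth F (k + Suc n) * \<xi> ^ (k + Suc n)) =
        fps_nth F (k + Suc n) * \<xi> ^ Suc k" for k
      using \<open>\<xi> \<noteq> 0\<close> by (simp add: power_add power_inverse field_simps)
    moreover have "inverse \<xi> ^ n * (0 - ?f n) = - fps_nth (F * Abs_fps (\<lambda>n. inverse \<xi> ^ n)) n"
      using \<open>\<xi> \<noteq> 0\<close> by (simp add: power_inverse)
    ultimately have *: "(\<lambda>k. fps_nth F (k + Suc n) * \<xi> ^ Suc k)
        sums - fps_nth (F * Abs_fps (\<lambda>n. inverse \<xi> ^ n)) n"
      by (simp only:)
    have le: "norm (fps_nth F (k + Suc n) * \<xi> ^ Suc k) \<le> norm (fps_nth F (k + Suc n))" for k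
      using power_le_one[of "norm \<xi>" "Suc k"] assms(3)
      by (simp only: norm_mult norm_power mult_left_le norm_ge_zero)
    have "norm (\<Sum>k. fps_nth F (k + Suc n) * \<xi> ^ Suc k) \<le> tail n"
      unfolding tail_def
      by (rule norm_suminf_le[OF le summable_ignore_initial_segment[OF summ]])
    then show ?thesis
      using sums_unique[OF *] by (metis norm_minus_cancel)
  qed
  ultimately show "fps_nth (F * Abs_fps (\<lambda>n. inverse \<xi> ^ n)) \<longlonglongrightarrow> 0"
    using Lim_null_comparison[OF always_eventually] by blast
qed

section \<open>The scheme in terms of generating functions\<close>

lemma numerical_solution_fps_iff:
  "numerical_solution (fps_nth W) z f u \<longleftrightarrow> Abs_fps u = Abs_fps f + fps_const z * (Abs_fps u * W)"
  by (simp add: numerical_solution_def fps_eq_iff fps_mult_nth[of "Abs_fps u"]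
      mult.commute[of "fps_nth W _"])

text \<open>The weights of \<open>B / A\<close> are not absolutely summable, since \<open>A\<close>
  but not \<open>B\<close> vanishes at \<open>1\<close>; multiplying the scheme by \<open>A\<close>
  leaves absolutely summable multipliers of \<open>u\<close> and \<open>f\<close>. The equation
  between \<open>A\<close> and \<open>z * B\<close> also makes sense where \<open>B / A\<close> is
  infinite.\<close>

theorem stability_region_fps_l1_quotient:
  assumes A: "A \<in> fps_l1" and B: "B \<in> fps_l1" and A0: "fps_nth A 0 \<noteq> 0" and A1: "eval_fps A 1 = 0"
    and no_common_zero: "\<And>\<xi>. norm \<xi> \<le> 1 \<Longrightarrow> eval_fps A \<xi> = 0 \<Longrightarrow> eval_fps B \<xi> \<noteq> 0"
  shows "stability_region (fps_nth (B / A)) =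
    {z. \<forall>\<xi>. norm \<xi> \<le> 1 \<longrightarrow> eval_fps A \<xi> \<noteq> z * eval_fps B \<xi>}"
proof (intro set_eqI iffI)
  have sol: "numerical_solution (fps_nth (B / A)) z f u \<longleftrightarrow>
      (A - fps_const z * B) * Abs_fps u = A * Abs_fps f" for z f u
  proof -
    have "A \<noteq> 0" using A0 by auto
    have "A * (B / A) = B"
      using A0 by (simp add: fps_divide_unit mult.left_commute inverse_mult_eq_1')
    then have "A * (Abs_fps f + fps_const z * (Abs_fps u * (B / A))) =
        A * Abs_fps f + fps_const z * (Abs_fps u * B)"
      by (simp add: algebra_simps)
    then have "Abs_fps u = Abs_fps f + fps_const z * (Abs_fps u * (B / A)) \<longleftrightarrow>
        A * Abs_fps u = A * Abs_fps f + fps_const z * (Abs_fps u * B)"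
      using \<open>A \<noteq> 0\<close> mult_left_cancel by metis
    then show ?thesis
      unfolding numerical_solution_fps_iff by (auto simp: algebra_simps)
  qed
  have w0: "fps_nth (B / A) 0 = fps_nth B 0 / fps_nth A 0"
    using A0 by (simp add: fps_divide_unit divide_inverse)
  have E: "A - fps_const z * B \<in> fps_l1" for z
    using A B by (intro fps_l1_diff fps_l1_mult fps_l1_const)
  note eval_E = eval_fps_l1_diff_cmult[OF A B]
  fix z
  {
    assume z: "z \<in> {z. \<forall>\<xi>. norm \<xi> \<le> 1 \<longrightarrow> eval_fps A \<xi> \<noteq> z * eval_fps B \<xi>}"
    define E' where "E' = A - fps_const z * B"
    have E': "E' \<in> fps_l1" "inverse E' \<in> fps_l1"
      using z by (auto simp: E'_def E eval_E intro!: fps_l1_inverse)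
    have E'0: "fps_nth E' 0 \<noteq> 0"
      using z[simplified, rule_format, of 0] by (simp add: E'_def eval_fps_at_0)
    show "z \<in> stability_region (fps_nth (B / A))"
      unfolding stability_region_def mem_Collect_eq
    proof (intro conjI allI impI)
      show "1 - z * fps_nth (B / A) 0 \<noteq> 0"
        using E'0 A0 by (simp add: w0 E'_def field_simps)
      fix f u :: "nat \<Rightarrow> complex"
      assume fu: "convergent f \<and> numerical_solution (fps_nth (B / A)) z f u"
      then have "E' * Abs_fps u = A * Abs_fps f"
        by (simp add: sol E'_def)
      then have "Abs_fps u = inverse E' * A * Abs_fps f"
        by (metis E'0 inverse_mult_eq_1 mult.assoc mult_1)
      moreover have "eval_fps (inverse E' * A) 1 = 0"
        using A1 by (simp add: eval_fps_l1_mult E' A)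
      then have "fps_nth (inverse E' * A * Abs_fps f) \<longlonglongrightarrow> 0"
        using fu by (intro fps_l1_mult_convergent_sequence fps_l1_mult E' A) auto
      ultimately show "u \<longlonglongrightarrow> 0"
        by (metis fps_nth_Abs_fps_fun)
    qed
  next
    assume z: "z \<in> stability_region (fps_nth (B / A))"
    show "z \<in> {z. \<forall>\<xi>. norm \<xi> \<le> 1 \<longrightarrow> eval_fps A \<xi> \<noteq> z * eval_fps B \<xi>}"
    proof (intro CollectI allI impI notI)
      fix \<xi> :: complex
      assume \<xi>: "norm \<xi> \<le> 1" and eq: "eval_fps A \<xi> = z * eval_fps B \<xi>"
      have stable: "u \<longlonglongrightarrow> 0"
        if "convergent f" "(A - fps_const z * B) * Abs_fps u = A * Abs_fps f" for f u
        using z that by (auto simp: stability_region_def sol)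
      have "\<xi> \<noteq> 0"
        using z eq A0 by (auto simp: stability_region_def w0 eval_fps_at_0)
      show False
      proof (cases "eval_fps A \<xi> = 0")
        case True
        then have "z = 0"
          using eq no_common_zero[OF \<xi>] by auto
        then have "(\<lambda>n. 1 :: complex) \<longlonglongrightarrow> 0"
          by (intro stable[of "\<lambda>n. 1"]) (simp_all add: convergent_const)
        then show False
          by (simp add: LIMSEQ_const_iff)
      next
        case False
        define V where "V = Abs_fps (\<lambda>n. inverse \<xi> ^ n)"
        have "fps_nth ((A - fps_const z * B) * V) \<longlonglongrightarrow> 0"
          unfolding V_def using eval_E[OF \<xi>, of z] eq
          by (intro fps_l1_geometric_limit(2) E \<open>\<xi> \<noteq> 0\<close> \<xi>) simp
        \<comment> \<open>Take \<open>f\<close> as the coefficients of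
          \<open>(A - fps_const z * B) * V\<close> and \<open>u\<close> as those of
          \<open>A * V\<close>; the scheme then holds by commutativity.\<close>
        then have "fps_nth (A * V) \<longlonglongrightarrow> 0"
          by (intro stable[of "fps_nth ((A - fps_const z * B) * V)"])
             (auto simp: convergent_def fps_nth_inverse mult_ac)
        \<comment> \<open>Multiplication by the bounded sequence \<open>\<xi> ^ n\<close> keeps a
          null sequence null, yet it recovers the partial sums of \<open>A\<close> at
          \<open>\<xi>\<close>, whose limit is nonzero.\<close>
        then have "(\<lambda>n. \<xi> ^ n * fps_nth (A * V) n) \<longlonglongrightarrow> 0"
        proof (rule Lim_null_comparison[rotated, OF tendsto_norm_zero])
          show "\<forall>\<^sub>F n in sequentially. norm (\<xi> ^ n * fps_nth (A * V) n) \<le> norm (fps_nth (A * V) n)"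
            using \<xi> by (intro always_eventually allI)
              (simp add: norm_mult norm_power power_le_one mult_left_le_one_le)
        qed
        moreover have "(\<lambda>n. \<xi> ^ n * fps_nth (A * V) n) \<longlonglongrightarrow> eval_fps A \<xi>"
          unfolding V_def by (rule fps_l1_geometric_limit(1)[OF A \<open>\<xi> \<noteq> 0\<close> \<xi>])
        ultimately show False
          using False LIMSEQ_unique by blast
      qed
    qed
  }
qed

subsection \<open>Binomial series and power branches\<close>

text \<open>For \<open>k \<ge> 1\<close> the number \<open>(a gchoose k) * (- 1) ^ k\<close> is
  negative, and for \<open>k = 0\<close> it is \<open>1 = 2 - 1\<close>; so the sum of absolute
  values is \<open>2\<close> minus the alternating sum, which equals
  \<open>(- 1) ^ n * (a - 1 gchoose n) > 0\<close>.\<close>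

lemma sum_abs_gbinomial_le:
  fixes a :: real
  assumes "0 < a" "a < 1"
  shows "(\<Sum>k\<le>n. \<bar>a gchoose k\<bar>) \<le> 2"
proof -
  have pos: "(- 1) ^ m * (a - 1 gchoose m) > 0" for m
    using assms by (simp add: gbinomial_pochhammer pochhammer_pos flip: power_mult_distrib)
  have "\<bar>a gchoose k\<bar> = (if k = 0 then 2 else 0) - (a gchoose k) * (- 1) ^ k" for k
  proof (cases k)
    case (Suc m)
    have "- ((a gchoose k) * (- 1) ^ k) = a / real k * ((- 1) ^ m * (a - 1 gchoose m))"
      using gbinomial_absorption'[of k a] Suc by simp
    also have "\<dots> > 0"
      using assms(1) Suc by (intro mult_pos_pos[OF _ pos]) auto
    finally have "- ((a gchoose k) * (- 1) ^ k) > 0" .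
    moreover from this have "\<bar>a gchoose k\<bar> = \<bar>- ((a gchoose k) * (- 1) ^ k)\<bar>"
      by (simp add: abs_mult)
    ultimately show ?thesis
      using Suc by simp
  qed simp
  then have "(\<Sum>k\<le>n. \<bar>a gchoose k\<bar>) = 2 - (\<Sum>k\<le>n. (a gchoose k) * (- 1) ^ k)"
    by (simp add: sum_subtractf)
  also have "\<dots> \<le> 2"
    using pos[of n] by (simp add: gbinomial_sum_lower_neg)
  finally show ?thesis .
qed

definition binomial_fps :: "real \<Rightarrow> real \<Rightarrow> complex fps" where
  "binomial_fps a c = Abs_fps (\<lambda>n. of_real ((a gchoose n) * c ^ n))"

lemma binomial_fps_in_l1:
  assumes "0 < a" "a < 1" "\<bar>c\<bar> \<le> 1"
  shows "binomial_fps a c \<in> fps_l1"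
proof (rule fps_l1I)
  fix n
  have "norm (fps_nth (binomial_fps a c) k) \<le> \<bar>a gchoose k\<bar>" for k
    using power_le_one[of "\<bar>c\<bar>" k] assms(3)
    by (auto simp: binomial_fps_def abs_mult power_abs intro!: mult_left_le
        simp flip: of_real_power of_real_mult)
  then have "(\<Sum>k\<le>n. norm (fps_nth (binomial_fps a c) k)) \<le> (\<Sum>k\<le>n. \<bar>a gchoose k\<bar>)"
    by (rule sum_mono)
  also have "\<dots> \<le> 2"
    using assms by (intro sum_abs_gbinomial_le)
  finally show "(\<Sum>k\<le>n. norm (fps_nth (binomial_fps a c) k)) \<le> 2" .
qed

lemma Re_one_plus_bounds:
  fixes w :: complex
  assumes "norm w \<le> 1"
  shows "Re (1 + w) \<ge> 0" and "norm w < 1 \<Longrightarrow> Re (1 + w) > 0"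
  using abs_Re_le_cmod[of w] assms by auto

text \<open>Inside the disc this is the binomial theorem. It extends to the circle by continuity:
  \<open>1 + w\<close> stays in the closed right half-plane, which meets the branch cut only at
  \<open>0\<close>, where the principal power is continuous because \<open>a > 0\<close>.\<close>

lemma eval_binomial_fps:
  assumes "0 < a" "a < 1" "\<bar>c\<bar> \<le> 1" "norm z \<le> 1"
  shows "eval_fps (binomial_fps a c) z = (1 + of_real c * z) powr of_real a"
proof -
  let ?F = "binomial_fps a 1"
  have scale: "eval_fps (binomial_fps a c) z = eval_fps ?F (of_real c * z)"
    by (simp add: eval_fps_def binomial_fps_def power_mult_distrib mult.assoc)
  have "eval_fps ?F w - (1 + w) powr of_real a = 0" if "w \<in> cball 0 1" for w
  proof (rule continuous_constant_on_closure[of "ball 0 1"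
        "\<lambda>w. eval_fps ?F w - (1 + w) powr of_real a"])
    have "continuous_on (cball 0 1) (\<lambda>w. eval_fps ?F w - (1 + w) powr of_real a)"
      using assms(1,2) Re_one_plus_bounds(1)
      by (intro continuous_on_diff continuous_on_eval_fps_l1 binomial_fps_in_l1
          continuous_on_powr_complex continuous_intros) auto
    then show "continuous_on (closure (ball 0 1)) (\<lambda>w. eval_fps ?F w - (1 + w) powr of_real a)"
      by simp
    have "?F = fps_binomial (of_real a)"
      by (simp add: fps_eq_iff binomial_fps_def gbinomial_prod_rev)
    then show "eval_fps ?F x - (1 + x) powr of_real a = 0" if "x \<in> ball 0 1" for x
      using that by (simp add: eval_fps_binomial)
  qed (use that in simp)
  moreover have "of_real c * z \<in> cball 0 1"
    using assms(3,4) by (simp add: norm_mult mult_le_one)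
  ultimately show ?thesis
    by (simp add: scale)
qed

section \<open>Uniqueness of power branches\<close>

lemma holomorphic_log_unique_up_to_constant:
  assumes "L holomorphic_on S" "M holomorphic_on S" "open S" "convex S"
    and eq: "\<And>x. x \<in> S \<Longrightarrow> exp (L x) = exp (M x)"
  obtains c where "\<And>x. x \<in> S \<Longrightarrow> L x = M x + c"
proof -
  let ?D = "\<lambda>x. L x - M x"
  have hol: "?D holomorphic_on S"
    by (intro holomorphic_intros assms)
  have "(?D has_field_derivative 0) (at x within S)" if x: "x \<in> S" for x
  proof -
    have D: "(?D has_field_derivative deriv ?D x) (at x)"
      using hol \<open>open S\<close> x by (rule holomorphic_derivI)
    \<comment> \<open>\<open>exp (?D x)\<close> is identically \<open>1\<close> on \<open>S\<close>;
      comparing its two derivatives gives \<open>deriv ?D x = 0\<close>, as \<open>exp\<close> has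
      no zero.\<close>
    have "((\<lambda>x. exp (?D x)) has_field_derivative exp (?D x) * deriv ?D x) (at x)"
      by (rule DERIV_fun_exp[OF D])
    moreover have "((\<lambda>x. exp (?D x)) has_field_derivative 0) (at x)"
      by (rule has_field_derivative_transform_within_open[OF DERIV_const[of 1] \<open>open S\<close> x])
         (simp add: exp_diff eq)
    ultimately have "deriv ?D x = 0"
      using DERIV_unique by fastforce
    with D show ?thesis
      by (simp add: has_field_derivative_at_within)
  qed
  from has_field_derivative_zero_constant[OF \<open>convex S\<close> this]
  obtain c where "\<And>x. x \<in> S \<Longrightarrow> ?D x = c" by blast
  then show thesis
    by (intro that[of c]) (auto simp: algebra_simps)
qed

text \<open>The chosen branch comes from some logarithm of \<open>F\<close>, which differs from
  \<open>M\<close> by a constant \<open>c\<close> with \<open>exp c = 1\<close>. The branch then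
  differs from the expected one by the factor \<open>exp (of_real a * c)\<close> of modulus
  \<open>1\<close>, and positivity at \<open>0\<close> forces this factor to be
  \<open>1\<close>.\<close>

lemma power_branch_eqI:
  assumes M: "M holomorphic_on ball 0 1" "\<And>\<xi>. \<xi> \<in> ball 0 1 \<Longrightarrow> exp (M \<xi>) = F \<xi>" "M 0 \<in> \<real>"
    and \<xi>: "\<xi> \<in> ball 0 1"
  shows "power_branch a F \<xi> = exp (of_real a * M \<xi>)"
proof -
  let ?h = "\<lambda>\<xi>. exp (of_real a * M \<xi>)"
  obtain t where t: "M 0 = of_real t"
    using M(3) by (auto elim: Reals_cases)
  then have h0: "?h 0 = of_real (exp (a * t))"
    by (simp flip: exp_of_real)
  then have "is_power_branch a F ?h"
    unfolding is_power_branch_def using M(1,2) exp_gt_zero by blast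
  then have "is_power_branch a F (power_branch a F)"
    unfolding power_branch_def by (rule someI[where P = "is_power_branch a F"])
  then obtain L r where L: "L holomorphic_on ball 0 1" "\<And>\<xi>. \<xi> \<in> ball 0 1 \<Longrightarrow> exp (L \<xi>) = F \<xi>"
    "\<And>\<xi>. \<xi> \<in> ball 0 1 \<Longrightarrow> power_branch a F \<xi> = exp (of_real a * L \<xi>)"
    and r: "r > 0" "power_branch a F 0 = of_real r"
    unfolding is_power_branch_def by blast
  obtain c where c: "\<And>x. x \<in> ball 0 1 \<Longrightarrow> L x = M x + c"
    using holomorphic_log_unique_up_to_constant[OF L(1) M(1)] L(2) M(2) by auto
  have eq: "power_branch a F x = ?h x * exp (of_real a * c)" if "x \<in> ball 0 1" for x
    using L(3)[OF that] c[OF that] by (simp add: ring_distribs exp_add)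
  have "exp (M 0 + c) = exp (M 0)"
    using c[of 0] L(2)[of 0] M(2)[of 0] by simp
  then have "exp c = 1" by (simp add: exp_add)
  then have "Re c = 0" by (metis norm_exp_eq_Re exp_eq_one_iff norm_one)
  then have "norm (exp (of_real a * c)) = 1" by simp
  moreover have "of_real r = of_real (exp (a * t)) * exp (of_real a * c)"
    using eq[of 0] r(2) h0 by simp
  then have "exp (of_real a * c) = of_real (r / exp (a * t))"
    by (simp add: field_simps)
  moreover have "r / exp (a * t) > 0" using r(1) by simp
  ultimately have "exp (of_real a * c) = 1" by (metis abs_of_pos norm_of_real of_real_1)
  then show ?thesis using eq[OF \<xi>] by simp
qed

section \<open>Continuous extension to the Riemann sphere\<close>

lemma sphere_extension_quotient:
  assumes a: "continuous_on (cball 0 1) a" and b: "continuous_on (cball 0 1) b" and \<xi>: "norm \<xi> \<le> 1"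
    and no_common_zero: "a \<xi> = 0 \<Longrightarrow> b \<xi> \<noteq> 0"
    and \<omega>: "\<And>\<eta>. norm \<eta> < 1 \<Longrightarrow> a \<eta> \<noteq> 0 \<and> \<omega> \<eta> = b \<eta> / a \<eta>"
  shows "sphere_extension \<omega> \<xi> = (if a \<xi> = 0 then None else Some (b \<xi> / a \<xi>))" (is "_ = ?l")
proof -
  let ?F = "at \<xi> within ball 0 1"
  have nt: "?F \<noteq> bot"
    using \<xi> by (simp add: trivial_limit_within islimpt_ball)
  have ev: "\<forall>\<^sub>F \<eta> in ?F. a \<eta> \<noteq> 0 \<and> \<omega> \<eta> = b \<eta> / a \<eta>"
    by (auto simp: eventually_at_filter \<omega>)
  have lim: "(a \<longlongrightarrow> a \<xi>) ?F" "(b \<longlongrightarrow> b \<xi>) ?F"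
    using a b \<xi> by (auto simp: continuous_on_def
        intro!: tendsto_within_subset[OF _ ball_subset_cball])
  have "limitin riemann_sphere (\<lambda>\<eta>. Some (\<omega> \<eta>)) ?l ?F"
  proof (cases "a \<xi> = 0")
    case True
    have "filterlim a (at 0) ?F"
      unfolding filterlim_at using lim(1) ev True by (auto elim: eventually_mono)
    from filterlim_divide_at_infinity[OF lim(2) this no_common_zero[OF True]]
    have inf: "filterlim \<omega> at_infinity ?F"
      by (rule filterlim_cong[THEN iffD1, OF refl refl, rotated])
         (use ev in \<open>auto elim: eventually_mono\<close>)
    \<comment> \<open>Open neighbourhoods of infinity are complements of compact sets, so they
      contain all values of sufficiently large modulus.\<close>
    have "\<forall>\<^sub>F \<eta> in ?F. Some (\<omega> \<eta>) \<in> U" if U: "openin riemann_sphere U" "None \<in> U" for U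
    proof -
      obtain C where C: "compact C" "U = insert None (Some ` (UNIV - C))"
        using U by (auto simp: openin_Alexandroff_compactification)
      then obtain K where K: "\<And>x. x \<in> C \<Longrightarrow> norm x \<le> K"
        using compact_imp_bounded by (metis bounded_iff)
      have "\<forall>\<^sub>F \<eta> in ?F. norm (\<omega> \<eta>) \<ge> \<bar>K\<bar> + 1"
        using inf[unfolded filterlim_at_infinity[OF order_refl], rule_format, of "\<bar>K\<bar> + 1"] by simp
      then show ?thesis
      proof eventually_elim
        case (elim \<eta>)
        then have "\<omega> \<eta> \<notin> C" using K[of "\<omega> \<eta>"] by auto
        then show ?case using C(2) by auto
      qed
    qed
    then show ?thesis using True by (simp add: limitin_def)
  next
    case False
    have "((\<lambda>\<eta>. b \<eta> / a \<eta>) \<longlongrightarrow> b \<xi> / a \<xi>) ?F"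
      by (intro tendsto_divide lim False)
    moreover have "\<forall>\<^sub>F \<eta> in ?F. b \<eta> / a \<eta> = \<omega> \<eta>"
      using ev by eventually_elim simp
    ultimately have "limitin euclidean \<omega> (b \<xi> / a \<xi>) ?F"
      by (simp add: tendsto_cong)
    from continuous_map_limit[OF continuous_map_Some this] show ?thesis
      using False by (simp add: o_def)
  qed
  note limit = this
  have "Hausdorff_space riemann_sphere"
    by (simp add: Hausdorff_space_Alexandroff_compactification locally_compact_space_euclidean)
  from limitin_Hausdorff_unique[OF _ limit nt this] show ?thesis
    unfolding sphere_extension_def by (intro the_equality limit)
qed

text \<open>The condition that \<open>z\<close> is the inverse of \<open>\<omega>\<close> at
  \<open>\<xi>\<close> becomes \<open>eval_fps A \<xi> = z * eval_fps B \<xi>\<close>. At a zero of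
  \<open>A\<close> both say \<open>z = 0\<close>; at a zero of \<open>B\<close> neither holds for
  any \<open>z\<close>.\<close>

theorem stability_region_eq_complement:
  assumes A: "A \<in> fps_l1" and B: "B \<in> fps_l1" and A1: "eval_fps A 1 = 0"
    and no_common_zero: "\<And>\<xi>. norm \<xi> \<le> 1 \<Longrightarrow> eval_fps A \<xi> = 0 \<Longrightarrow> eval_fps B \<xi> \<noteq> 0"
    and \<omega>: "\<And>\<eta>. norm \<eta> < 1 \<Longrightarrow> eval_fps A \<eta> \<noteq> 0 \<and> \<omega> \<eta> = eval_fps B \<eta> / eval_fps A \<eta>"
  shows "stability_region (quadrature_weights \<omega>) =
    UNIV - {z. \<exists>\<xi>. norm \<xi> \<le> 1 \<and> sphere_inverse (sphere_extension \<omega> \<xi>) = Some z}"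
proof -
  have A0: "fps_nth A 0 \<noteq> 0"
    using \<omega>[of 0] by (simp add: eval_fps_at_0)
  have exp: "(\<lambda>\<eta>. eval_fps B \<eta> / eval_fps A \<eta>) has_fps_expansion B / A"
    using A0 by (intro has_fps_expansion_divide' fps_l1_has_fps_expansion A B) auto
  have ev: "\<forall>\<^sub>F \<eta> in nhds 0. eval_fps B \<eta> / eval_fps A \<eta> = \<omega> \<eta>"
    by (rule eventually_mono[OF eventually_nhds_in_open[of "ball 0 1" "0::complex"]])
       (use \<omega> in auto)
  have "\<omega> has_fps_expansion B / A"
    using exp has_fps_expansion_cong[OF ev refl] by simp
  then have "quadrature_weights \<omega> = fps_nth (B / A)"
    by (simp add: quadrature_weights_def fps_expansion_eqI fun_eq_iff)
  moreover have "sphere_inverse (sphere_extension \<omega> \<xi>) = Some z \<longleftrightarrow> eval_fps A \<xi> = z * eval_fps B \<xi>"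
    if \<xi>: "norm \<xi> \<le> 1" for \<xi> z
  proof -
    have "sphere_extension \<omega> \<xi> =
        (if eval_fps A \<xi> = 0 then None else Some (eval_fps B \<xi> / eval_fps A \<xi>))"
      by (rule sphere_extension_quotient)
         (use \<xi> no_common_zero \<omega> continuous_on_eval_fps_l1 A B in auto)
    then show ?thesis
      using no_common_zero[OF \<xi>] by (auto simp: field_simps)
  qed
  ultimately show ?thesis
    using stability_region_fps_l1_quotient[OF A B A0 A1 no_common_zero] by auto
qed

subsection \<open>The two families of methods\<close>

definition theta_gamma :: "real \<Rightarrow> real" where
  "theta_gamma \<theta> = (1 - 2 * \<theta>) / (3 - 2 * \<theta>)"

lemma theta_poly_factor:
  assumes "\<theta> \<le> 1"
  shows "theta_poly \<theta> \<xi> =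
    of_real (3/2 - \<theta>) * (1 + of_real (- 1) * \<xi>) * (1 + of_real (- theta_gamma \<theta>) * \<xi>)"
proof -
  have "(3/2 - \<theta>) * theta_gamma \<theta> = 1/2 - \<theta>"
    using assms by (simp add: theta_gamma_def field_simps)
  then have g: "of_real (1/2 - \<theta>) = (of_real (3/2 - \<theta>) * of_real (theta_gamma \<theta>) :: complex)"
    by (metis of_real_mult)
  have h: "of_real (2 - 2 * \<theta>) = (of_real (3/2 - \<theta>) + of_real (1/2 - \<theta>) :: complex)"
    by (simp flip: of_real_add)
  show ?thesis
    unfolding theta_poly_def h unfolding g of_real_minus of_real_1 by algebra
qed

text \<open>Equality occurs only for \<open>\<theta> = 1\<close>, where
  \<open>theta_gamma \<theta> = - 1\<close> and \<open>theta_poly \<theta>\<close> acquires a second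
  boundary zero at \<open>-1\<close>.\<close>

lemma abs_theta_gamma_le: "\<theta> \<le> 1 \<Longrightarrow> \<bar>theta_gamma \<theta>\<bar> \<le> 1"
  by (simp add: theta_gamma_def abs_if field_simps)

text \<open>The series of the \<open>\<alpha>\<close>-th power of
  \<open>theta_poly \<theta>\<close>, formed factor by factor so that each factor is a principal
  power with a binomial series summable up to the circle.\<close>

definition theta_fps :: "real \<Rightarrow> real \<Rightarrow> complex fps" where
  "theta_fps \<alpha> \<theta> = fps_const (of_real ((3/2 - \<theta>) powr \<alpha>)) *
     (binomial_fps \<alpha> (- 1) * binomial_fps \<alpha> (- theta_gamma \<theta>))"

lemma one_plus_cmult_not_nonpos:
  fixes \<xi> :: complex
  assumes "\<bar>c\<bar> \<le> 1" "norm \<xi> < 1"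
  shows "1 + of_real c * \<xi> \<notin> \<real>\<^sub>\<le>\<^sub>0"
proof -
  have "norm (of_real c * \<xi>) < 1"
    using assms by (simp add: norm_mult)
      (metis abs_ge_zero le_less_trans mult_left_le_one_le norm_ge_zero)
  then have "Re (1 + of_real c * \<xi>) > 0"
    by (intro Re_one_plus_bounds) auto
  then show ?thesis
    by (auto simp: complex_nonpos_Reals_iff)
qed

lemma one_plus_cmult_nonzero:
  fixes \<xi> :: complex
  assumes "\<bar>c\<bar> \<le> 1" "norm \<xi> < 1"
  shows "1 + of_real c * \<xi> \<noteq> 0"
  using one_plus_cmult_not_nonpos[OF assms] by fastforce

lemma exp_of_real_ln_powr:
  "p > 0 \<Longrightarrow> exp (of_real a * of_real (ln p)) = (of_real (p powr a) :: complex)"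
  by (simp add: powr_def flip: of_real_mult exp_of_real)

lemma holomorphic_on_Ln_one_plus_cmult:
  "\<bar>c\<bar> \<le> 1 \<Longrightarrow> (\<lambda>\<xi>. Ln (1 + of_real c * \<xi>)) holomorphic_on ball 0 1"
  using one_plus_cmult_not_nonpos by (intro holomorphic_intros) auto

context
  fixes \<alpha> \<theta> :: real
  assumes \<alpha>: "0 < \<alpha>" "\<alpha> < 1" and \<theta>: "\<theta> \<le> 1"
begin

lemma theta_fps_in_l1: "theta_fps \<alpha> \<theta> \<in> fps_l1"
  unfolding theta_fps_def using \<alpha> abs_theta_gamma_le[OF \<theta>]
  by (intro fps_l1_mult fps_l1_const binomial_fps_in_l1) auto

lemma eval_theta_fps:
  assumes "norm \<xi> \<le> 1"
  shows "eval_fps (theta_fps \<alpha> \<theta>) \<xi> = of_real ((3/2 - \<theta>) powr \<alpha>) *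
    ((1 + of_real (- 1) * \<xi>) powr of_real \<alpha> * (1 + of_real (- theta_gamma \<theta>) * \<xi>) powr of_real \<alpha>)"
  unfolding theta_fps_def using \<alpha> abs_theta_gamma_le[OF \<theta>] assms
  by (simp add: eval_fps_l1_mult fps_l1_mult binomial_fps_in_l1 eval_binomial_fps)

lemma eval_theta_fps_eq_0_iff:
  assumes "norm \<xi> \<le> 1"
  shows "eval_fps (theta_fps \<alpha> \<theta>) \<xi> = 0 \<longleftrightarrow> \<xi> = 1 \<or> of_real (theta_gamma \<theta>) * \<xi> = 1"
  unfolding eval_theta_fps[OF assms] using \<theta> by auto

text \<open>A logarithm of \<open>theta_poly \<theta>\<close> is assembled from principal logarithms
  of its factors, each of which avoids the branch cut in the open disc. It is real at
  \<open>0\<close>, so it selects the positive branch.\<close>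

lemma power_branch_theta_poly:
  assumes \<xi>: "norm \<xi> < 1"
  shows "power_branch \<alpha> (theta_poly \<theta>) \<xi> = eval_fps (theta_fps \<alpha> \<theta>) \<xi>"
proof -
  let ?a = "\<lambda>\<xi>::complex. 1 + of_real (- 1) * \<xi>"
    and ?b = "\<lambda>\<xi>::complex. 1 + of_real (- theta_gamma \<theta>) * \<xi>"
  define M where "M = (\<lambda>\<xi>. of_real (ln (3/2 - \<theta>)) + (Ln (?a \<xi>) + Ln (?b \<xi>)))"
  have c: "\<bar>- 1\<bar> \<le> (1::real)" "\<bar>- theta_gamma \<theta>\<bar> \<le> 1"
    using abs_theta_gamma_le[OF \<theta>] by auto
  have nz: "?a \<xi> \<noteq> 0" "?b \<xi> \<noteq> 0" if "norm \<xi> < 1" for \<xi>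
    using one_plus_cmult_nonzero[OF c(1) that] one_plus_cmult_nonzero[OF c(2) that] by auto
  have p: "3/2 - \<theta> > 0" using \<theta> by simp
  have "power_branch \<alpha> (theta_poly \<theta>) \<xi> = exp (of_real \<alpha> * M \<xi>)"
  proof (rule power_branch_eqI)
    show "M holomorphic_on ball 0 1"
      unfolding M_def using c
      by (intro holomorphic_on_add holomorphic_on_const holomorphic_on_Ln_one_plus_cmult)
    show "exp (M \<xi>) = theta_poly \<theta> \<xi>" if "\<xi> \<in> ball 0 1" for \<xi>
      using nz[OF that[unfolded mem_ball_0]] p unfolding theta_poly_factor[OF \<theta>] M_def exp_add
      by (simp only: exp_Ln exp_of_real exp_ln mult.assoc not_False_eq_True)
  qed (use \<xi> in \<open>auto simp: M_def\<close>)
  also have "\<dots> = eval_fps (theta_fps \<alpha> \<theta>) \<xi>"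
    unfolding M_def ring_distribs exp_add exp_of_real_ln_powr[OF p]
    using eval_theta_fps[of \<xi>] nz[OF \<xi>] \<xi> by (simp add: powr_def)
  finally show ?thesis .
qed

end

text \<open>In the closed disc the denominator vanishes at \<open>1\<close> and, for
  \<open>\<theta> = 1\<close> only, at \<open>-1\<close>. The numerator is \<open>1\<close> at
  \<open>1\<close>, and for \<open>\<theta> = 1\<close> it is \<open>1 - 2 * \<alpha>\<close> at
  \<open>-1\<close>; a common zero thus arises exactly for \<open>\<theta> = 1\<close> and
  \<open>\<alpha> = 1/2\<close>, hence the case distinction.\<close>

lemma stability_region_BN:
  assumes \<alpha>: "0 < \<alpha>" "\<alpha> < 1" and \<theta>: "\<theta> \<le> 1"
  shows "stability_region (quadrature_weights (BN_gen \<alpha> \<theta>)) =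
    UNIV - {z. \<exists>\<xi>. norm \<xi> \<le> 1 \<and> sphere_inverse (sphere_extension (BN_gen \<alpha> \<theta>) \<xi>) = Some z}"
proof -
  note pb = power_branch_theta_poly[OF \<alpha> \<theta>]
  have gamma: "\<theta> = 1 \<and> \<xi> = - 1" if "of_real (theta_gamma \<theta>) * \<xi> = 1" "norm \<xi> \<le> 1" for \<xi> :: complex
  proof -
    have "1 = \<bar>theta_gamma \<theta>\<bar> * norm \<xi>"
      using that(1) by (metis norm_mult norm_of_real norm_one)
    also have "\<dots> \<le> \<bar>theta_gamma \<theta>\<bar>"
      using that(2) by (simp add: mult_left_le)
    finally have "\<theta> = 1"
      using \<theta> by (auto simp: theta_gamma_def abs_if field_simps split: if_splits)
    then show ?thesis
      using that(1) by (simp add: theta_gamma_def minus_equation_iff)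
  qed
  have nz: "eval_fps (theta_fps \<alpha> \<theta>) \<eta> \<noteq> 0" if "norm \<eta> < 1" for \<eta>
    using that gamma[of \<eta>] by (subst eval_theta_fps_eq_0_iff[OF \<alpha> \<theta>]) auto
  show ?thesis
  proof (cases "\<theta> = 1 \<and> \<alpha> = 1/2")
    case False
    let ?A = "theta_fps \<alpha> \<theta>"
    let ?B = "fps_const (of_real (1 - \<alpha> * \<theta>)) + fps_const (of_real (\<alpha> * \<theta>)) * fps_X"
    have B: "?B \<in> fps_l1"
      by (intro fps_l1_add fps_l1_mult fps_l1_const fps_l1_X)
    have eval_B: "eval_fps ?B \<xi> = of_real (1 - \<alpha> * \<theta>) + of_real (\<alpha> * \<theta>) * \<xi>"
      if "norm \<xi> \<le> 1" for \<xi> :: complex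
      using that by (simp add: eval_fps_l1_add eval_fps_l1_mult fps_l1_mult)
    show ?thesis
    proof (rule stability_region_eq_complement[OF theta_fps_in_l1[OF \<alpha> \<theta>] B])
      show "eval_fps ?A 1 = 0"
        using eval_theta_fps_eq_0_iff[OF \<alpha> \<theta>, of 1] by simp
      show "eval_fps ?B \<xi> \<noteq> 0" if \<xi>: "norm \<xi> \<le> 1" and "eval_fps ?A \<xi> = 0" for \<xi>
      proof -
        have "\<xi> = 1 \<or> \<theta> = 1 \<and> \<xi> = - 1"
          using that gamma[of \<xi>] eval_theta_fps_eq_0_iff[OF \<alpha> \<theta> \<xi>] by auto
        then show ?thesis
        proof
          assume "\<theta> = 1 \<and> \<xi> = - 1"
          then have "eval_fps ?B \<xi> = of_real (1 - 2 * \<alpha>)"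
            using eval_B[OF \<xi>] by simp
          then show ?thesis
            using False \<open>\<theta> = 1 \<and> \<xi> = - 1\<close> by (simp del: of_real_diff of_real_mult)
        qed (use eval_B[OF \<xi>] in simp)
      qed
      show "eval_fps ?A \<eta> \<noteq> 0 \<and> BN_gen \<alpha> \<theta> \<eta> = eval_fps ?B \<eta> / eval_fps ?A \<eta>" if "norm \<eta> < 1" for \<eta>
        using that nz pb eval_B[of \<eta>] by (simp add: BN_gen_def)
    qed
  next
    case True \<comment> \<open>numerator and denominator then share the factor \<open>(1 + \<xi>) powr \<alpha>\<close>, now cancelled\<close>
    then have "\<alpha> = 1/2" "\<theta> = 1" by auto
    let ?A = "fps_const (of_real ((1/2) powr \<alpha>)) * binomial_fps \<alpha> (- 1)"
    let ?B = "fps_const (1/2) * binomial_fps \<alpha> 1"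
    have eval_A: "eval_fps ?A \<xi> = of_real ((1/2) powr \<alpha>) * (1 - \<xi>) powr of_real \<alpha>"
      and eval_B: "eval_fps ?B \<xi> = 1/2 * (1 + \<xi>) powr of_real \<alpha>" if "norm \<xi> \<le> 1" for \<xi>
      using that \<alpha> by (simp_all add: eval_fps_l1_mult binomial_fps_in_l1 eval_binomial_fps)
    show ?thesis
    proof (rule stability_region_eq_complement)
      show "?A \<in> fps_l1" "?B \<in> fps_l1"
        using \<alpha> by (intro fps_l1_mult fps_l1_const binomial_fps_in_l1; simp)+
      show "eval_fps ?A 1 = 0"
        using eval_A[of 1] by simp
      show "eval_fps ?B \<xi> \<noteq> 0" if "norm \<xi> \<le> 1" "eval_fps ?A \<xi> = 0" for \<xi>
        using that(2) unfolding eval_A[OF that(1)] eval_B[OF that(1)] by auto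
      show "eval_fps ?A \<eta> \<noteq> 0 \<and> BN_gen \<alpha> \<theta> \<eta> = eval_fps ?B \<eta> / eval_fps ?A \<eta>"
        if \<eta>: "norm \<eta> < 1" for \<eta>
      proof -
        let ?s = "(1 + \<eta>) powr of_real \<alpha>"
        have "1 + \<eta> \<noteq> 0" "1 - \<eta> \<noteq> 0"
          using \<eta> by (auto simp: add_eq_0_iff)
        have "?s * ?s = (1 + \<eta>) powr (of_real \<alpha> + of_real \<alpha>)"
          by (rule powr_add[symmetric])
        also have "of_real \<alpha> + of_real \<alpha> = (1 :: complex)"
          unfolding \<open>\<alpha> = 1/2\<close> by simp
        finally have sq: "?s * ?s = 1 + \<eta>" by simp
        have s_nz: "?s \<noteq> 0"
          using \<open>1 + \<eta> \<noteq> 0\<close> by simp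
        have num: "of_real (1 - \<alpha> * \<theta>) + of_real (\<alpha> * \<theta>) * \<eta> = 1/2 * (1 + \<eta>)"
          unfolding \<open>\<alpha> = 1/2\<close> \<open>\<theta> = 1\<close> by (simp add: ring_distribs)
        have BN: "BN_gen \<alpha> \<theta> \<eta> =
            (1/2 * (1 + \<eta>)) / (of_real ((1/2) powr \<alpha>) * ((1 - \<eta>) powr of_real \<alpha> * ?s))"
          unfolding BN_gen_def pb[OF \<eta>] eval_theta_fps[OF \<alpha> \<theta> less_imp_le[OF \<eta>]] num
          using \<open>\<theta> = 1\<close> by (simp add: theta_gamma_def)
        let ?d = "of_real ((1/2) powr \<alpha>) * (1 - \<eta>) powr of_real \<alpha>"
        have "BN_gen \<alpha> \<theta> \<eta> = (1/2 * ?s * ?s) / (?d * ?s)"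
          unfolding BN mult.assoc sq ..
        also have "\<dots> = (1/2 * ?s) / ?d"
          using s_nz by (rule nonzero_mult_divide_mult_cancel_right)
        finally show ?thesis
          unfolding eval_A[OF less_imp_le[OF \<eta>]] eval_B[OF less_imp_le[OF \<eta>]]
          using \<open>1 - \<eta> \<noteq> 0\<close> by simp
      qed
    qed
  qed
qed

text \<open>For \<open>\<theta> \<le> 1/2\<close> the number \<open>theta_gamma \<theta>\<close>
  lies in \<open>[0, 1)\<close>, so the denominator vanishes only at \<open>1\<close>, where the
  numerator does not; there is no exceptional case.\<close>

lemma stability_region_BT:
  assumes \<alpha>: "0 < \<alpha>" "\<alpha> < 1" and \<theta>: "\<theta> \<le> 1/2"
  shows "stability_region (quadrature_weights (BT_gen \<alpha> \<theta>)) =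
    UNIV - {z. \<exists>\<xi>. norm \<xi> \<le> 1 \<and> sphere_inverse (sphere_extension (BT_gen \<alpha> \<theta>) \<xi>) = Some z}"
proof -
  have \<theta>1: "\<theta> \<le> 1" using \<theta> by simp
  \<comment> \<open>\<open>c\<close> normalises the numerator to constant term \<open>1\<close>;
    \<open>\<theta> \<le> 1/2\<close> gives \<open>\<bar>c\<bar> \<le> 1\<close>, so its binomial
    series is absolutely summable.\<close>
  define c where "c = \<theta> / (1 - \<theta>)"
  have c: "\<bar>c\<bar> \<le> 1"
    using \<theta> by (simp add: c_def abs_if field_simps)
  have q: "1 - \<theta> > 0" using \<theta> by simp
  have "of_real \<theta> = (of_real (1 - \<theta>) * of_real c :: complex)"
    using q unfolding c_def of_real_mult[symmetric] by simp
  then have num: "of_real (1 - \<theta>) + of_real \<theta> * \<xi> = of_real (1 - \<theta>) * (1 + of_real c * \<xi>)"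
    for \<xi> :: complex
    by (simp only: ring_distribs mult_1_right mult.assoc)
  let ?A = "theta_fps \<alpha> \<theta>"
  let ?B = "fps_const (of_real ((1 - \<theta>) powr \<alpha>)) * binomial_fps \<alpha> c"
  have B: "?B \<in> fps_l1"
    using \<alpha> c by (intro fps_l1_mult fps_l1_const binomial_fps_in_l1)
  have eval_B: "eval_fps ?B \<xi> = of_real ((1 - \<theta>) powr \<alpha>) * (1 + of_real c * \<xi>) powr of_real \<alpha>"
    if "norm \<xi> \<le> 1" for \<xi>
    using that \<alpha> c by (simp add: eval_fps_l1_mult binomial_fps_in_l1 eval_binomial_fps)
  have A_0_iff: "eval_fps ?A \<xi> = 0 \<longleftrightarrow> \<xi> = 1" if \<xi>: "norm \<xi> \<le> 1" for \<xi>
  proof -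
    have "norm (of_real (theta_gamma \<theta>) * \<xi>) \<le> \<bar>theta_gamma \<theta>\<bar>"
      using \<xi> by (simp add: norm_mult mult_left_le)
    also have "\<dots> < 1"
      using \<theta> by (simp add: theta_gamma_def abs_if field_simps)
    finally show ?thesis
      using eval_theta_fps_eq_0_iff[OF \<alpha> \<theta>1 \<xi>] by auto
  qed
  show ?thesis
  proof (rule stability_region_eq_complement[OF theta_fps_in_l1[OF \<alpha> \<theta>1] B])
    show "eval_fps ?A 1 = 0"
      by (simp add: A_0_iff)
    show "eval_fps ?B \<xi> \<noteq> 0" if "norm \<xi> \<le> 1" "eval_fps ?A \<xi> = 0" for \<xi>
    proof -
      have "\<xi> = 1" using that A_0_iff by simp
      moreover have "1 + c \<noteq> 0" using q by (simp add: c_def field_simps)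
      then have "1 + of_real c \<noteq> (0::complex)" by (metis of_real_1 of_real_add of_real_eq_0_iff)
      ultimately show ?thesis using eval_B[OF that(1)] q by simp
    qed
    show "eval_fps ?A \<eta> \<noteq> 0 \<and> BT_gen \<alpha> \<theta> \<eta> = eval_fps ?B \<eta> / eval_fps ?A \<eta>" if \<eta>: "norm \<eta> < 1" for \<eta>
    proof
      show "eval_fps ?A \<eta> \<noteq> 0" using A_0_iff[of \<eta>] \<eta> by auto
      let ?a = "\<lambda>\<xi>::complex. 1 + of_real (- 1) * \<xi>"
    and ?b = "\<lambda>\<xi>::complex. 1 + of_real (- theta_gamma \<theta>) * \<xi>"
    and ?c = "\<lambda>\<xi>::complex. 1 + of_real c * \<xi>"
      \<comment> \<open>Logarithms of the factors, added for the numerator and subtracted for the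
        denominator; the result is real at \<open>0\<close>.\<close>
      define M where "M = (\<lambda>\<xi>. of_real (ln (1 - \<theta>)) + Ln (?c \<xi>) -
        (of_real (ln (3/2 - \<theta>)) + (Ln (?a \<xi>) + Ln (?b \<xi>))))"
      have cs: "\<bar>- 1\<bar> \<le> (1::real)" "\<bar>- theta_gamma \<theta>\<bar> \<le> 1"
        using abs_theta_gamma_le[OF \<theta>1] by auto
      have nz: "?a \<xi> \<noteq> 0" "?b \<xi> \<noteq> 0" "?c \<xi> \<noteq> 0" if "norm \<xi> < 1" for \<xi>
        using one_plus_cmult_nonzero[OF cs(1) that] one_plus_cmult_nonzero[OF cs(2) that]
          one_plus_cmult_nonzero[OF c that] by auto
      have p: "3/2 - \<theta> > 0" using \<theta> by simp
      have "BT_gen \<alpha> \<theta> \<eta> = exp (of_real \<alpha> * M \<eta>)"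
        unfolding BT_gen_def
      proof (rule power_branch_eqI)
        show "M holomorphic_on ball 0 1"
          unfolding M_def using c cs
          by (intro holomorphic_on_add holomorphic_on_diff holomorphic_on_const
              holomorphic_on_Ln_one_plus_cmult)
        show "exp (M \<xi>) = (of_real (1 - \<theta>) + of_real \<theta> * \<xi>) / theta_poly \<theta> \<xi>"
          if "\<xi> \<in> ball 0 1" for \<xi>
          using nz[OF that[unfolded mem_ball_0]] p q
          unfolding num theta_poly_factor[OF \<theta>1] M_def exp_add exp_diff
          by (simp only: exp_Ln exp_of_real exp_ln mult.assoc not_False_eq_True)
      qed (use \<eta> in \<open>auto simp: M_def\<close>)
      also have "\<dots> = eval_fps ?B \<eta> / eval_fps ?A \<eta>"
        unfolding M_def ring_distribs right_diff_distrib exp_add exp_diff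
          exp_of_real_ln_powr[OF p] exp_of_real_ln_powr[OF q]
        using eval_theta_fps[OF \<alpha> \<theta>1, of \<eta>] eval_B[of \<eta>] nz[OF \<eta>] \<eta> by (simp add: powr_def)
      finally show "BT_gen \<alpha> \<theta> \<eta> = eval_fps ?B \<eta> / eval_fps ?A \<eta>" .
    qed
  qed
qed

theorem theorem4p3:
  fixes \<alpha> \<theta> :: real and \<omega> :: "complex \<Rightarrow> complex"
  assumes "0 < \<alpha>" and "\<alpha> < 1"
    and "(\<omega> = BT_gen \<alpha> \<theta> \<and> \<theta> \<le> 1/2) \<or> (\<omega> = BN_gen \<alpha> \<theta> \<and> \<theta> \<le> 1)"
  shows "stability_region (quadrature_weights \<omega>) =
           UNIV - {z. \<exists>\<xi>. norm \<xi> \<le> 1 \<and> sphere_inverse (sphere_extension \<omega> \<xi>) = Some z}"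
  using assms stability_region_BT stability_region_BN by blast

end
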